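(* Let ${}^f\sigma(t)$, $t\ge0$, be a subordinator with Laplace exponent the Bernstein function $f$, and let ${}^fL(t)=\inf\{s>0:{}^f\sigma(s)>t\}$ be its inverse. Then $$\int_w^\infty\mathbb E\bigl[{}^fL(t)\;{}^fL(t+s)\bigr]\,ds=+\infty\qquad\text{for all }w,t>0.$$
   Context: A Bernstein function is one of the form $f(x)=a+bx+\int_0^\infty(1-e^{-sx})\bar\nu(ds)$, $x>0$, with $a,b\ge0$ and $\bar\nu$ a non-negative measure on $(0,\infty)$ satisfying $\int_0^\infty(z\wedge1)\,\bar\nu(dz)<\infty$. A subordinator ${}^f\sigma(t)$, $t\ge0$, with Laplace exponent $f$ is a process with values in $[0,\infty]$ ($\infty$ absorbing), non-decreasing right-continuous paths started at $0$, and independent and homogeneous increments up to its lifetime $\zeta=\inf\{t\ge 0:{}^f\sigma(t)=\infty\}$, with $\mathbb E e^{-\lambda\,{}^f\sigma(t)}=e^{-tf(\lambda)}$ for $\lambda>0$ (convention $e^{-\infty}=0$). *)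

theory Defs
  imports "HOL-Probability.Probability"
begin

definition bernstein_function :: "(real \<Rightarrow> real) \<Rightarrow> bool" where
  "bernstein_function f \<longleftrightarrow>
     (\<exists>a b. \<exists>\<nu> :: real measure.
        a \<ge> 0 \<and> b \<ge> 0 \<and>
        sets \<nu> = sets (restrict_space borel {0<..}) \<and>
        (\<integral>\<^sup>+ z. ennreal (min z 1) \<partial>\<nu>) < \<infinity> \<and>
        (\<forall>x>0. f x = a + b * x + (\<integral>s. (1 - exp (- s * x)) \<partial>\<nu>)))"

text \<open>The map \<open>x \<mapsto> e\<^sup>-\<^sup>x\<close> on \<open>[0, \<infinity>]\<close>, with the convention that it vanishes at \<open>\<infinity>\<close>.\<close>

definition exp_neg :: "ennreal \<Rightarrow> real" where
  "exp_neg x = (if x = \<infinity> then 0 else exp (- enn2real x))"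

text \<open>A process is indexed by real times, only the times \<open>t \<ge> 0\<close> being relevant. In the following
  two definitions the infimum of the empty set is \<open>\<infinity>\<close>.\<close>

definition lifetime :: "(real \<Rightarrow> 'a \<Rightarrow> ennreal) \<Rightarrow> 'a \<Rightarrow> ennreal" where
  "lifetime \<sigma> \<omega> = Inf {ennreal t |t. 0 \<le> t \<and> \<sigma> t \<omega> = \<infinity>}"

definition inverse_process :: "(real \<Rightarrow> 'a \<Rightarrow> ennreal) \<Rightarrow> real \<Rightarrow> 'a \<Rightarrow> ennreal" where
  "inverse_process \<sigma> t \<omega> = Inf {ennreal s |s. 0 < s \<and> ennreal t < \<sigma> s \<omega>}"

definition past_events :: "'a measure \<Rightarrow> (real \<Rightarrow> 'a \<Rightarrow> ennreal) \<Rightarrow> real \<Rightarrow> 'a set set" where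
  "past_events M \<sigma> t =
     sigma_sets (space M) {\<sigma> u -` B \<inter> space M |u B. 0 \<le> u \<and> u \<le> t \<and> B \<in> sets borel}"

text \<open>Independent and homogeneous increments up to the lifetime \<open>\<zeta>\<close>: conditionally on \<open>t < \<zeta>\<close>, the
  increment over \<open>[t, t + s]\<close> (which is \<open>\<infinity>\<close> if the process is killed in that interval) is
  independent of the past up to time \<open>t\<close> and has the unconditional law of the process at time \<open>s\<close>.
  Nothing is required when the conditioning event is null.\<close>

definition indep_homogeneous_increments ::
    "'a measure \<Rightarrow> (real \<Rightarrow> 'a \<Rightarrow> ennreal) \<Rightarrow> bool" where
  "indep_homogeneous_increments M \<sigma> \<longleftrightarrow>
     (\<forall>s\<ge>0. \<forall>t\<ge>0.
        let E = {\<omega> \<in> space M. ennreal t < lifetime \<sigma> \<omega>};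
            N = uniform_measure M E;
            X = (\<lambda>\<omega>. \<sigma> (t + s) \<omega> - \<sigma> t \<omega>)
        in emeasure M E \<noteq> 0 \<longrightarrow>
             prob_space.indep_set N (past_events M \<sigma> t) {X -` B \<inter> space M |B. B \<in> sets borel} \<and>
             distr N borel X = distr M borel (\<sigma> s))"

definition subordinator ::
    "'a measure \<Rightarrow> (real \<Rightarrow> real) \<Rightarrow> (real \<Rightarrow> 'a \<Rightarrow> ennreal) \<Rightarrow> bool" where
  "subordinator M f \<sigma> \<longleftrightarrow>
     (\<forall>t\<ge>0. \<sigma> t \<in> borel_measurable M) \<and>
     (\<forall>\<omega>\<in>space M. \<sigma> 0 \<omega> = 0) \<and>
     (\<forall>\<omega>\<in>space M. mono_on {0..} (\<lambda>t. \<sigma> t \<omega>)) \<and>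
     (\<forall>\<omega>\<in>space M. \<forall>t\<ge>0. continuous (at_right t) (\<lambda>u. \<sigma> u \<omega>)) \<and>
     (\<forall>\<omega>\<in>space M. \<forall>s\<ge>0. \<forall>t\<ge>s. \<sigma> s \<omega> = \<infinity> \<longrightarrow> \<sigma> t \<omega> = \<infinity>) \<and>
     indep_homogeneous_increments M \<sigma> \<and>
     (\<forall>t\<ge>0. \<forall>l>0. (\<integral>\<omega>. exp_neg (ennreal l * \<sigma> t \<omega>) \<partial>M) = exp (- t * f l))"

end

theory Submission imports Defs begin

text \<open>Since \<open>L\<close> is monotone, \<open>E[L(t) L(t+s)] \<ge> E[L(t)\<^sup>2]\<close>. Right-continuity at \<open>0\<close> gives \<open>L(t) > 0\<close>
  everywhere, so the integrand is bounded below by a positive constant not depending on \<open>s\<close>.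
  To avoid the measurability of \<open>L\<close>, the constant is taken as \<open>d\<^sup>2 P(\<sigma>(d) \<le> t)\<close> for a small \<open>d > 0\<close>.\<close>

text \<open>By monotonicity the path stays at or below \<open>t\<close> on [0, d], so
  \<open>d\<close> is a lower bound of the set whose infimum is taken. An empty set causes no
  trouble, its infimum being infinite.\<close>

lemma inverse_process_ge:
  assumes mono: "mono_on {0..} (\<lambda>u. \<sigma> u \<omega>)" and "0 \<le> d" and le: "\<sigma> d \<omega> \<le> ennreal t"
  shows "ennreal d \<le> inverse_process \<sigma> t \<omega>"
  unfolding inverse_process_def
proof (rule Inf_greatest)
  fix x assume "x \<in> {ennreal s |s. 0 < s \<and> ennreal t < \<sigma> s \<omega>}"
  then obtain s where s: "x = ennreal s" "0 < s" "ennreal t < \<sigma> s \<omega>" by blast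
  have "\<not> s \<le> d"
    using mono_onD[OF mono, of s d] s \<open>0 \<le> d\<close> le by (auto simp: not_le[symmetric])
  then show "ennreal d \<le> x" using s by (simp add: ennreal_leI)
qed

text \<open>Each path starts at 0 and is right-continuous there, hence stays below \<open>t\<close>
  for a short, path-dependent time. Countably many null events cannot cover the space, so one
  deterministic \<open>d\<close> works with positive probability.\<close>

lemma subordinator_small_time:
  assumes "prob_space M" and "subordinator M f \<sigma>" and "t > 0"
  obtains d where "d > 0" and "{\<omega> \<in> space M. \<sigma> d \<omega> \<le> ennreal t} \<in> sets M"
    and "emeasure M {\<omega> \<in> space M. \<sigma> d \<omega> \<le> ennreal t} > 0"
proof -
  interpret prob_space M by fact
  \<comment> \<open>The times 1/(n+1) tend to 0, so one of them falls below the random threshold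
    \<open>b\<close> of any given path.\<close>
  define A where "A n = {\<omega> \<in> space M. \<sigma> (inverse (real (Suc n))) \<omega> \<le> ennreal t}" for n
  have A: "A n \<in> sets M" for n
  proof -
    have [measurable]: "\<sigma> (inverse (real (Suc n))) \<in> borel_measurable M"
      using assms(2) by (simp add: subordinator_def)
    show ?thesis unfolding A_def by measurable
  qed
  have "\<exists>n. \<omega> \<in> A n" if "\<omega> \<in> space M" for \<omega>
  proof -
    have "continuous (at_right 0) (\<lambda>u. \<sigma> u \<omega>)" and "\<sigma> 0 \<omega> = 0"
      using assms(2) that by (simp_all add: subordinator_def)
    then have "((\<lambda>u. \<sigma> u \<omega>) \<longlongrightarrow> 0) (at_right 0)"
      by (simp add: continuous_within)
    then have "\<forall>\<^sub>F u in at_right 0. \<sigma> u \<omega> < ennreal t"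
      using \<open>t > 0\<close> by (intro order_tendstoD(2)) auto
    then obtain b :: real where "b > 0" and b: "\<And>u. 0 < u \<Longrightarrow> u < b \<Longrightarrow> \<sigma> u \<omega> < ennreal t"
      by (auto simp: eventually_at_right_field)
    obtain n where "inverse (real (Suc n)) < b"
      using reals_Archimedean[OF \<open>b > 0\<close>] by blast
    then have "\<omega> \<in> A n"
      using b[of "inverse (real (Suc n))"] that by (simp add: A_def less_imp_le)
    then show ?thesis ..
  qed
  then have "(\<Union>n. A n) = space M" by (auto simp: A_def)
  then have "\<exists>n. emeasure M (A n) \<noteq> 0"
    using emeasure_UN_eq_0[of M A] A emeasure_space_1 by auto
  then obtain n where "emeasure M (A n) > 0" by (auto simp: zero_less_iff_neq_zero)
  then show thesis
    using that[of "inverse (real (Suc n))"] A[of n] by (simp add: A_def)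
qed

theorem mainTheorem4:
  fixes M :: "'a measure" and f :: "real \<Rightarrow> real"
    and \<sigma> :: "real \<Rightarrow> 'a \<Rightarrow> ennreal" and w t :: real
  assumes "prob_space M"
    and "bernstein_function f"
    and "subordinator M f \<sigma>"
    and "w > 0" and "t > 0"
  shows "(\<integral>\<^sup>+ s \<in> {w..}.
            (\<integral>\<^sup>+ \<omega>. inverse_process \<sigma> t \<omega> * inverse_process \<sigma> (t + s) \<omega> \<partial>M) \<partial>lborel) = \<infinity>"
proof -
  obtain d where "d > 0" and sets: "{\<omega> \<in> space M. \<sigma> d \<omega> \<le> ennreal t} \<in> sets M"
    and pos: "emeasure M {\<omega> \<in> space M. \<sigma> d \<omega> \<le> ennreal t} > 0"
    using subordinator_small_time[OF assms(1,3,5)] .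
  let ?A = "{\<omega> \<in> space M. \<sigma> d \<omega> \<le> ennreal t}"
  \<comment> \<open>On \<open>?A\<close> both factors of the integrand are at least
    \<open>d\<close>; hence the square of \<open>d\<close>.\<close>
  define c where "c = ennreal d * ennreal d * emeasure M ?A"
  have "c > 0" using \<open>d > 0\<close> pos by (simp add: c_def ennreal_zero_less_mult_iff)
  have lower: "c \<le> (\<integral>\<^sup>+ \<omega>. inverse_process \<sigma> t \<omega> * inverse_process \<sigma> (t + s) \<omega> \<partial>M)"
    if "s \<ge> w" for s
  proof -
    have "c = (\<integral>\<^sup>+ \<omega>. ennreal d * ennreal d * indicator ?A \<omega> \<partial>M)"
      using sets by (simp add: c_def nn_integral_cmult_indicator)
    also have "\<dots> \<le> (\<integral>\<^sup>+ \<omega>. inverse_process \<sigma> t \<omega> * inverse_process \<sigma> (t + s) \<omega> \<partial>M)"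
    \<comment> \<open>The comparison is pointwise: off \<open>?A\<close> the left side is 0.\<close>
    proof (rule nn_integral_mono)
      fix \<omega> assume "\<omega> \<in> space M"
      then have mono: "mono_on {0..} (\<lambda>u. \<sigma> u \<omega>)"
        using assms(3) by (simp add: subordinator_def)
      have "ennreal d * ennreal d \<le> inverse_process \<sigma> t \<omega> * inverse_process \<sigma> (t + s) \<omega>"
        if le: "\<sigma> d \<omega> \<le> ennreal t"
      proof (intro mult_mono)
        \<comment> \<open>The same event serves the higher level \<open>t + s\<close>, which makes
          the bound uniform in \<open>s\<close>.\<close>
        have "\<sigma> d \<omega> \<le> ennreal (t + s)"
          using le \<open>s \<ge> w\<close> \<open>w > 0\<close> by (elim order_trans) (simp add: ennreal_leI)
        with mono show "ennreal d \<le> inverse_process \<sigma> (t + s) \<omega>"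
          using \<open>d > 0\<close> by (intro inverse_process_ge) auto
        show "ennreal d \<le> inverse_process \<sigma> t \<omega>"
          using mono \<open>d > 0\<close> le by (intro inverse_process_ge) auto
      qed auto
      then show "ennreal d * ennreal d * indicator ?A \<omega>
          \<le> inverse_process \<sigma> t \<omega> * inverse_process \<sigma> (t + s) \<omega>"
        by (auto simp: indicator_def)
    qed
    finally show ?thesis .
  qed
  have "emeasure lborel {w..} = \<infinity>"
  proof (rule ccontr)
    assume "emeasure lborel {w..} \<noteq> \<infinity>"
    then obtain r where r: "emeasure lborel {w..} = ennreal r" "r \<ge> 0"
      by (cases "emeasure lborel {w..}") auto
    \<comment> \<open>If the half-line had finite length \<open>r\<close>, it would still contain an
      interval of length \<open>r + 1\<close>.\<close>
    have "ennreal (r + 1) = emeasure lborel {w..w + (r + 1)}" using r by simp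
    also have "\<dots> \<le> emeasure lborel {w..}" by (intro emeasure_mono) auto
    finally show False using r by simp
  qed
  \<comment> \<open>Positivity of \<open>c\<close> is essential here, since 0 times infinity is 0 in
    \<open>ennreal\<close>.\<close>
  then have "\<infinity> = c * emeasure lborel {w..}"
    using \<open>c > 0\<close> by (simp add: ennreal_mult_top)
  also have "\<dots> = (\<integral>\<^sup>+ s. c * indicator {w..} s \<partial>lborel)"
    by (simp add: nn_integral_cmult_indicator)
  also have "\<dots> \<le> (\<integral>\<^sup>+ s \<in> {w..}.
      (\<integral>\<^sup>+ \<omega>. inverse_process \<sigma> t \<omega> * inverse_process \<sigma> (t + s) \<omega> \<partial>M) \<partial>lborel)"
    using lower by (intro nn_integral_mono) (auto simp: indicator_def)
  finally show ?thesis by (simp add: top_unique)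
qed

end
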